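(* Let $d\ge1$, $A>0$, and let $u_0(x)=e^{A|x|^2}v(x)$, $x\in\mathbb{R}^d$, with $0\le v\in L^1_{\rm loc}(\mathbb{R}^d)$, where $u_0$ has optimal index $\varepsilon_0=\varepsilon_0(u_0)=A$. For $x\in\mathbb{R}^d$ put $$I_v(x):=\int_{\mathbb{R}^d}e^{2A\langle x,z\rangle}v(z)\,\mathrm{d}z\in[0,\infty].$$ Then: (i) for $x\in\mathbb{R}^d$, $\tau_{-x}u_0\in L^1_{\varepsilon_0}(\mathbb{R}^d)$ if and only if $I_v(x)<\infty$; (ii) if moreover $0\le v\in L^1(\mathbb{R}^d)$, then the set of $x\in\mathbb{R}^d$ such that $I_v(x)<\infty$ is a convex set that contains $x=0$.
   Context: For $\varepsilon>0$, $L^1_\varepsilon(\mathbb{R}^d)=\{f\in L^1_{\rm loc}(\mathbb{R}^d):\int e^{-\varepsilon|x|^2}|f(x)|\,\mathrm{d}x<\infty\}$. The optimal index of $f\in L^1_{\rm loc}(\mathbb{R}^d)$ is $\varepsilon_0(f)=\inf\{\varepsilon>0:f\in L^1_\varepsilon(\mathbb{R}^d)\}$. Translations are $\tau_yf(x)=f(x-y)$. $\langle\cdot,\cdot\rangle$ is the Euclidean inner product. *)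

theory Defs
  imports "HOL-Analysis.Analysis"
begin

text \<open>Functions stand for their almost-everywhere equivalence classes: measurability and integrals
  are taken with respect to the completed Lebesgue measure.\<close>

definition L1_loc :: "('a::euclidean_space \<Rightarrow> real) set" where
  "L1_loc = {f. \<forall>K. compact K \<longrightarrow> set_integrable lebesgue K f}"

definition L1_gauss :: "real \<Rightarrow> ('a::euclidean_space \<Rightarrow> real) set" where
  "L1_gauss \<epsilon> =
    {f \<in> L1_loc. (\<integral>\<^sup>+ x. ennreal (exp (- \<epsilon> * (norm x)\<^sup>2) * \<bar>f x\<bar>) \<partial>lebesgue) < \<infinity>}"

text \<open>The infimum is taken in the extended reals, so that it is infinite if \<open>f\<close> lies in
  no \<open>L1_gauss \<epsilon>\<close>.\<close>

definition optimal_index :: "('a::euclidean_space \<Rightarrow> real) \<Rightarrow> ereal" where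
  "optimal_index f = (INF \<epsilon> \<in> {\<epsilon>. 0 < \<epsilon> \<and> f \<in> L1_gauss \<epsilon>}. ereal \<epsilon>)"

definition translate :: "'a::euclidean_space \<Rightarrow> ('a \<Rightarrow> real) \<Rightarrow> 'a \<Rightarrow> real" where
  "translate y f = (\<lambda>x. f (x - y))"

text \<open>\<open>ennreal\<close> sends negative reals to \<open>0\<close>; this is harmless for \<open>v \<ge> 0\<close> almost everywhere.\<close>

definition I_transform :: "real \<Rightarrow> ('a::euclidean_space \<Rightarrow> real) \<Rightarrow> 'a \<Rightarrow> ennreal" where
  "I_transform A v x = (\<integral>\<^sup>+ z. ennreal (exp (2 * A * (x \<bullet> z)) * v z) \<partial>lebesgue)"

end

theory Submission
  imports Defs
begin

text \<open>
  Completing the square turns one weighted integral into the other. The change of variables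
  \<open>z = y + x\<close> replaces the Gaussian weight \<open>exp (- A \<bar>y\<bar>\<^sup>2)\<close> by \<open>exp (- A \<bar>z - x\<bar>\<^sup>2)\<close>, and
  \<open>- A \<bar>z - x\<bar>\<^sup>2 + A \<bar>z\<bar>\<^sup>2 = - A \<bar>x\<bar>\<^sup>2 + 2 A \<langle>x, z\<rangle>\<close>: the quadratic growth of \<open>u\<^sub>0\<close> cancels exactly,
  because the weight has the same rate \<open>A\<close>, and only a linear exponent survives. Hence
  \<open>\<integral> exp (- A \<bar>y\<bar>\<^sup>2) \<bar>u\<^sub>0 (y + x)\<bar> dy = exp (- A \<bar>x\<bar>\<^sup>2) I\<^sub>v(x)\<close>, which is
  \<open>nn_integral_gauss_translate\<close>; the factor in front is positive and finite, and local
  integrability passes from \<open>v\<close> to the translate of \<open>u\<^sub>0\<close>, so (i) follows.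

  For (ii), \<open>I\<^sub>v\<close> is an integral of the functions \<open>x \<mapsto> exp (2 A \<langle>x, z\<rangle>)\<close> against a nonnegative
  density. Each of them is convex, so \<open>I\<^sub>v\<close> is a convex function with values in \<open>[0, \<infinity>]\<close> and its
  domain of finiteness is convex. At the origin \<open>I\<^sub>v\<close> is the integral of \<open>v\<close>.
\<close>

text \<open>On the balls around the origin \<open>f\<close> is integrable, hence measurable, and \<open>f\<close> is the pointwise
  limit of its restrictions to these balls.\<close>

lemma L1_loc_borel_measurable:
  fixes f :: "'a::euclidean_space \<Rightarrow> real"
  assumes "f \<in> L1_loc"
  shows "f \<in> borel_measurable lebesgue"
proof (rule borel_measurable_LIMSEQ_metric)
  fix n :: nat
  have "set_integrable lebesgue (cball 0 (real n)) f"
    using assms by (auto simp: L1_loc_def)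
  then show "(\<lambda>x. indicat_real (cball 0 (real n)) x *\<^sub>R f x) \<in> borel_measurable lebesgue"
    unfolding set_integrable_def by (rule borel_measurable_integrable)
next
  fix x :: 'a
  obtain N :: nat where N: "norm x \<le> real N"
    using real_arch_simple by blast
  have "eventually (\<lambda>n. indicat_real (cball 0 (real n)) x *\<^sub>R f x = f x) sequentially"
    using eventually_ge_at_top[of N] by eventually_elim (use N in \<open>auto simp: indicator_def\<close>)
  then show "(\<lambda>n. indicat_real (cball 0 (real n)) x *\<^sub>R f x) \<longlonglongrightarrow> f x"
    by (rule tendsto_eventually)
qed

lemma continuous_imp_borel_measurable_lebesgue:
  fixes g :: "'a::euclidean_space \<Rightarrow> 'b::topological_space"
  assumes "continuous_on UNIV g"
  shows "g \<in> borel_measurable lebesgue"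
  using borel_measurable_continuous_onI[OF assms]
  by (simp add: measurable_completion)

lemma L1_loc_mult_continuous:
  fixes f g :: "'a::euclidean_space \<Rightarrow> real"
  assumes f: "f \<in> L1_loc" and g: "continuous_on UNIV g"
  shows "(\<lambda>x. g x * f x) \<in> L1_loc"
  unfolding L1_loc_def
proof (intro CollectI allI impI)
  fix K :: "'a set"
  assume K: "compact K"
  have "compact (g ` K)"
    using g K by (meson compact_continuous_image continuous_on_subset subset_UNIV)
  then have "bounded (g ` K)"
    by (rule compact_imp_bounded)
  then obtain C where C: "\<And>x. x \<in> K \<Longrightarrow> \<bar>g x\<bar> \<le> C"
    unfolding bounded_iff by auto
  have [measurable]: "f \<in> borel_measurable lebesgue" "g \<in> borel_measurable lebesgue"
    using f g by (simp_all add: L1_loc_borel_measurable continuous_imp_borel_measurable_lebesgue)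
  have [measurable]: "K \<in> sets lebesgue"
    using K by (simp add: borel_compact)
  show "set_integrable lebesgue K (\<lambda>x. g x * f x)"
  proof (rule set_integrable_bound)
    have "set_integrable lebesgue K f"
      using f K by (simp add: L1_loc_def)
    then show "set_integrable lebesgue K (\<lambda>x. C * f x)"
      by simp
    show "set_borel_measurable lebesgue K (\<lambda>x. g x * f x)"
      unfolding set_borel_measurable_def by measurable
    have "norm (g x * f x) \<le> norm (C * f x)" if "x \<in> K" for x
      using C[OF that] by (auto simp: abs_mult intro!: mult_right_mono)
    then show "AE x in lebesgue. x \<in> K \<longrightarrow> norm (g x * f x) \<le> norm (C * f x)"
      by simp
  qed
qed

lemma translation_measurable_lebesgue:
  "(\<lambda>x. a + x) \<in> lebesgue \<rightarrow>\<^sub>M (lebesgue :: 'a::euclidean_space measure)"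
  using lebesgue_affine_measurable[of "\<lambda>_. 1" a] by (simp add: euclidean_representation)

lemma distr_lebesgue_translation:
  "distr lebesgue lebesgue (\<lambda>x. a + x) = (lebesgue :: 'a::euclidean_space measure)"
  using lebesgue_affine_euclidean[of "\<lambda>_. 1" a]
  by (simp add: euclidean_representation density_1)

lemma nn_integral_lebesgue_translation:
  fixes f :: "'a::euclidean_space \<Rightarrow> ennreal"
  assumes "f \<in> borel_measurable lebesgue"
  shows "(\<integral>\<^sup>+ x. f (a + x) \<partial>lebesgue) = (\<integral>\<^sup>+ x. f x \<partial>lebesgue)"
  using nn_integral_distr[OF translation_measurable_lebesgue, of f a] assms
  by (simp add: distr_lebesgue_translation)

lemma L1_loc_translate:
  fixes f :: "'a::euclidean_space \<Rightarrow> real"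
  assumes f: "f \<in> L1_loc"
  shows "translate y f \<in> L1_loc"
  unfolding L1_loc_def
proof (intro CollectI allI impI)
  fix K :: "'a set"
  assume "compact K"
  then have K: "compact ((+) (- y) ` K)"
    by (rule compact_translation)
  then have "integrable (distr lebesgue lebesgue ((+) (- y))) (\<lambda>x. indicat_real ((+) (- y) ` K) x *\<^sub>R f x)"
    using f unfolding distr_lebesgue_translation L1_loc_def set_integrable_def by blast
  then have "integrable lebesgue (\<lambda>x. indicat_real ((+) (- y) ` K) (- y + x) *\<^sub>R f (- y + x))"
    by (rule integrable_distr[OF translation_measurable_lebesgue])
  moreover have "indicat_real ((+) (- y) ` K) (- y + x) = indicat_real K x" for x
    by (auto simp: indicator_def)
  ultimately show "set_integrable lebesgue K (translate y f)"
    by (simp add: set_integrable_def translate_def)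
qed

text \<open>Completing the square after the substitution \<open>z = x + y\<close>. Since \<open>I_transform\<close> cuts off the
  negative part of \<open>v\<close> while the left-hand side has an absolute value, nonnegativity of \<open>v\<close> almost
  everywhere is what makes the two sides agree.\<close>

lemma nn_integral_gauss_translate:
  fixes v :: "'a::euclidean_space \<Rightarrow> real"
  assumes v[measurable]: "v \<in> borel_measurable lebesgue" and nonneg: "AE x in lebesgue. 0 \<le> v x"
  shows "(\<integral>\<^sup>+ y. ennreal (exp (- A * (norm y)\<^sup>2) *
            \<bar>translate (- x) (\<lambda>z. exp (A * (norm z)\<^sup>2) * v z) y\<bar>) \<partial>lebesgue)
         = ennreal (exp (- A * (norm x)\<^sup>2)) * I_transform A v x"
proof -
  have square: "exp (- A * (norm (z - x))\<^sup>2) * exp (A * (norm z)\<^sup>2)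
      = exp (- A * (norm x)\<^sup>2) * exp (2 * A * (x \<bullet> z))" for z
    by (simp add: power2_norm_eq_inner inner_diff inner_commute algebra_simps flip: exp_add)
  have [measurable]: "(\<lambda>z. exp (2 * A * (x \<bullet> z))) \<in> borel_measurable lebesgue"
    "(\<lambda>z. exp (- A * (norm (z - x))\<^sup>2)) \<in> borel_measurable lebesgue"
    "(\<lambda>z::'a. exp (A * (norm z)\<^sup>2)) \<in> borel_measurable lebesgue"
    by (intro continuous_imp_borel_measurable_lebesgue continuous_intros)+
  let ?g = "\<lambda>z. ennreal (exp (- A * (norm (z - x))\<^sup>2) * \<bar>exp (A * (norm z)\<^sup>2) * v z\<bar>)"
  have "(\<integral>\<^sup>+ y. ennreal (exp (- A * (norm y)\<^sup>2) *
            \<bar>translate (- x) (\<lambda>z. exp (A * (norm z)\<^sup>2) * v z) y\<bar>) \<partial>lebesgue)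
        = (\<integral>\<^sup>+ y. ?g (x + y) \<partial>lebesgue)"
    by (simp add: translate_def add.commute)
  also have "\<dots> = (\<integral>\<^sup>+ z. ?g z \<partial>lebesgue)"
    by (rule nn_integral_lebesgue_translation) measurable
  also have "\<dots> = (\<integral>\<^sup>+ z. ennreal (exp (- A * (norm x)\<^sup>2)) *
                      ennreal (exp (2 * A * (x \<bullet> z)) * v z) \<partial>lebesgue)"
  proof (rule nn_integral_cong_AE)
    show "AE z in lebesgue. ?g z = ennreal (exp (- A * (norm x)\<^sup>2)) *
                      ennreal (exp (2 * A * (x \<bullet> z)) * v z)"
      using nonneg
    proof eventually_elim
      case (elim z)
      have "exp (- A * (norm (z - x))\<^sup>2) * \<bar>exp (A * (norm z)\<^sup>2) * v z\<bar>
          = exp (- A * (norm x)\<^sup>2) * (exp (2 * A * (x \<bullet> z)) * v z)"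
        using elim square[of z] by (simp add: abs_mult flip: mult.assoc)
      then show ?case
        by (simp add: ennreal_mult')
    qed
  qed
  also have "\<dots> = ennreal (exp (- A * (norm x)\<^sup>2)) * I_transform A v x"
    unfolding I_transform_def by (rule nn_integral_cmult) measurable
  finally show ?thesis .
qed

text \<open>Convexity of \<open>exp\<close> along the segment from \<open>x\<close> to \<open>y\<close>, integrated against the positive part
  of \<open>v\<close>.\<close>

lemma I_transform_convex:
  fixes v :: "'a::euclidean_space \<Rightarrow> real"
  assumes v[measurable]: "v \<in> borel_measurable lebesgue"
    and "0 \<le> s" "0 \<le> t" "s + t = 1"
  shows "I_transform A v (s *\<^sub>R x + t *\<^sub>R y)
         \<le> ennreal s * I_transform A v x + ennreal t * I_transform A v y"
proof -
  have [measurable]: "(\<lambda>z. exp (2 * A * (w \<bullet> z))) \<in> borel_measurable lebesgue" for w :: 'a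
    by (intro continuous_imp_borel_measurable_lebesgue continuous_intros)
  have pointwise: "ennreal (exp (2 * A * ((s *\<^sub>R x + t *\<^sub>R y) \<bullet> z)) * v z)
      \<le> ennreal s * ennreal (exp (2 * A * (x \<bullet> z)) * v z)
        + ennreal t * ennreal (exp (2 * A * (y \<bullet> z)) * v z)" for z
  proof -
    have "exp (s *\<^sub>R (2 * A * (x \<bullet> z)) + t *\<^sub>R (2 * A * (y \<bullet> z)))
        \<le> s * exp (2 * A * (x \<bullet> z)) + t * exp (2 * A * (y \<bullet> z))"
      using exp_convex assms(2-) unfolding convex_on_def by blast
    then have "exp (2 * A * ((s *\<^sub>R x + t *\<^sub>R y) \<bullet> z))
        \<le> s * exp (2 * A * (x \<bullet> z)) + t * exp (2 * A * (y \<bullet> z))"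
      by (simp add: inner_add_left algebra_simps)
    then have "ennreal (exp (2 * A * ((s *\<^sub>R x + t *\<^sub>R y) \<bullet> z))) * ennreal (v z)
        \<le> ennreal (s * exp (2 * A * (x \<bullet> z)) + t * exp (2 * A * (y \<bullet> z))) * ennreal (v z)"
      by (intro mult_right_mono ennreal_leI) auto
    then show ?thesis
      using assms(2,3) by (simp add: ennreal_mult' distrib_right mult.assoc)
  qed
  have "I_transform A v (s *\<^sub>R x + t *\<^sub>R y)
      \<le> (\<integral>\<^sup>+ z. ennreal s * ennreal (exp (2 * A * (x \<bullet> z)) * v z)
               + ennreal t * ennreal (exp (2 * A * (y \<bullet> z)) * v z) \<partial>lebesgue)"
    unfolding I_transform_def by (intro nn_integral_mono pointwise)
  also have "\<dots> = ennreal s * I_transform A v x + ennreal t * I_transform A v y"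
    unfolding I_transform_def by (simp add: nn_integral_add nn_integral_cmult)
  finally show ?thesis .
qed

lemma convex_I_transform_finite:
  fixes v :: "'a::euclidean_space \<Rightarrow> real"
  assumes "v \<in> borel_measurable lebesgue"
  shows "convex {x. I_transform A v x < \<infinity>}"
proof (rule convexI)
  fix x y :: 'a and s t :: real
  assume "x \<in> {x. I_transform A v x < \<infinity>}" "y \<in> {x. I_transform A v x < \<infinity>}"
    and st: "0 \<le> s" "0 \<le> t" "s + t = 1"
  then have "ennreal s * I_transform A v x + ennreal t * I_transform A v y < \<infinity>"
    by (simp add: ennreal_mult_less_top)
  then show "s *\<^sub>R x + t *\<^sub>R y \<in> {x. I_transform A v x < \<infinity>}"
    using le_less_trans[OF I_transform_convex[OF assms st]] by simp
qed

lemma I_transform_zero_finite: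
  fixes v :: "'a::euclidean_space \<Rightarrow> real"
  assumes "integrable lebesgue v"
  shows "I_transform A v 0 < \<infinity>"
proof -
  have "I_transform A v 0 \<le> (\<integral>\<^sup>+ z. ennreal (norm (v z)) \<partial>lebesgue)"
    unfolding I_transform_def by (intro nn_integral_mono ennreal_leI) simp
  also have "\<dots> < \<infinity>"
    using assms by (simp add: integrable_iff_bounded)
  finally show ?thesis .
qed

theorem lemma5p6:
  fixes A \<epsilon>\<^sub>0 :: real
    and u\<^sub>0 v :: "real ^ 'd \<Rightarrow> real"
  assumes "A > 0"
    and "v \<in> L1_loc"
    and "AE x in lebesgue. 0 \<le> v x"
    and "u\<^sub>0 = (\<lambda>x. exp (A * (norm x)\<^sup>2) * v x)"
    and "optimal_index u\<^sub>0 = ereal \<epsilon>\<^sub>0"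
    and "\<epsilon>\<^sub>0 = A"
  shows "(\<forall>x. translate (- x) u\<^sub>0 \<in> L1_gauss \<epsilon>\<^sub>0 \<longleftrightarrow> I_transform A v x < \<infinity>) \<and>
    (integrable lebesgue v \<longrightarrow>
      convex {x. I_transform A v x < \<infinity>} \<and> 0 \<in> {x. I_transform A v x < \<infinity>})"
proof (intro conjI allI impI)
  have v: "v \<in> borel_measurable lebesgue"
    using assms(2) by (rule L1_loc_borel_measurable)
  have "u\<^sub>0 \<in> L1_loc"
    unfolding assms(4) by (intro L1_loc_mult_continuous assms(2) continuous_intros)
  then have loc: "translate (- x) u\<^sub>0 \<in> L1_loc" for x
    by (rule L1_loc_translate)
  show "translate (- x) u\<^sub>0 \<in> L1_gauss \<epsilon>\<^sub>0 \<longleftrightarrow> I_transform A v x < \<infinity>" for x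
  proof -
    have "translate (- x) u\<^sub>0 \<in> L1_gauss \<epsilon>\<^sub>0 \<longleftrightarrow>
        ennreal (exp (- A * (norm x)\<^sup>2)) * I_transform A v x < \<infinity>"
      using loc[of x] nn_integral_gauss_translate[OF v assms(3), of A x]
      by (simp add: L1_gauss_def assms(4,6))
    also have "\<dots> \<longleftrightarrow> I_transform A v x < \<infinity>"
      by (auto simp: ennreal_mult_less_top)
    finally show ?thesis .
  qed
  show "convex {x. I_transform A v x < \<infinity>}"
    by (rule convex_I_transform_finite[OF v])
  show "0 \<in> {x. I_transform A v x < \<infinity>}" if "integrable lebesgue v"
    using I_transform_zero_finite[OF that] by simp
qed

end
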